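(* Let $T>0$, let $N\ge 1$ be an integer, put $\Delta t=T/N$ and $t_n=n\Delta t$ for $n=0,1,\dots,N$. Let $\lambda_0\in\mathbb{C}$ and $w_0=\lambda_0\,\Delta t$. Let $l\ge 1$ be an integer and $c=\sum_{k=0}^{l-1}\left(\tfrac12|\lambda_0|T\right)^k$. Then for every $w\in\mathbb{C}$ with $\Re w\le 0$ and every $n\in\{0,1,\dots,N\}$: (a) $|R_{\rm CNFE}(w,w_0)^n|\le e^{|\lambda_0|t_n}$, (b) $|R_{\rm CNFI}(w,w_0)^n|\le e^{c|\lambda_0|t_n}$, (c) $|R_{\rm IETR}(w,w_0)^n|\le e^{|\lambda_0|t_n}$, (d) $\|C_{\rm CNAB}(w,w_0)^n\|\le e^{2|\lambda_0|t_n}$, where $R_{\rm CNFE}$, $R_{\rm CNFI}$ (which depends on $l$), $R_{\rm IETR}$ and the $2\times2$ matrix $C_{\rm CNAB}$ are the stability functions, respectively the companion matrix, given in the context.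
   Context: $\Re$ denotes the real part, and $\|\cdot\|$ is the maximum norm for (complex) matrices, i.e. the matrix norm induced by the maximum vector norm (maximal absolute row sum). The following functions arise from applying four implicit-explicit time stepping schemes with step size $\Delta t$ to the scalar test equation $V'(t)=(\mu+\lambda_0)V(t)$, where $\mu$ is treated implicitly by the Crank--Nicolson method, $\lambda_0$ is treated explicitly, $w=\mu\Delta t$ and $w_0=\lambda_0\Delta t$. The first three schemes give a recurrence $V^n=R(w,w_0)V^{n-1}$ with $$R_{\rm CNFE}(w,w_0)=\frac{1+\tfrac12 w+w_0}{1-\tfrac12 w},$$ $$R_{\rm CNFI}(w,w_0)=\left(\frac{\tfrac12 w_0}{1-\tfrac12 w}\right)^l+\sum_{k=0}^{l-1}\left(\frac{\tfrac12 w_0}{1-\tfrac12 w}\right)^k\cdot\frac{1+\tfrac12 w+\tfrac12 w_0}{1-\tfrac12 w},$$ $$R_{\rm IETR}(w,w_0)=\frac{1+\tfrac12 w+w_0+\tfrac12(w+w_0)w_0}{1-\tfrac12 w}.$$ The fourth scheme gives a two-step recurrence $V^n=R_1(w,w_0)V^{n-1}+R_0(w,w_0)V^{n-2}$ with $$R_1(w,w_0)=\frac{1+\tfrac12 w+\tfrac32 w_0}{1-\tfrac12 w},\qquad R_0(w,w_0)=\frac{-\tfrac12 w_0}{1-\tfrac12 w},$$ and its companion matrix is $$C_{\rm CNAB}(w,w_0)=\begin{pmatrix}R_1(w,w_0)&R_0(w,w_0)\\1&0\end{pmatrix}.$$ *)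

theory Defs
  imports "HOL-Analysis.Analysis"
begin

definition R_CNFE :: "complex \<Rightarrow> complex \<Rightarrow> complex" where
  "R_CNFE w w0 = (1 + 1/2 * w + w0) / (1 - 1/2 * w)"

definition R_CNFI :: "nat \<Rightarrow> complex \<Rightarrow> complex \<Rightarrow> complex" where
  "R_CNFI l w w0 =
     (1/2 * w0 / (1 - 1/2 * w)) ^ l +
     (\<Sum>k<l. (1/2 * w0 / (1 - 1/2 * w)) ^ k * ((1 + 1/2 * w + 1/2 * w0) / (1 - 1/2 * w)))"

definition R_IETR :: "complex \<Rightarrow> complex \<Rightarrow> complex" where
  "R_IETR w w0 = (1 + 1/2 * w + w0 + 1/2 * (w + w0) * w0) / (1 - 1/2 * w)"

definition R1_CNAB :: "complex \<Rightarrow> complex \<Rightarrow> complex" where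
  "R1_CNAB w w0 = (1 + 1/2 * w + 3/2 * w0) / (1 - 1/2 * w)"

definition R0_CNAB :: "complex \<Rightarrow> complex \<Rightarrow> complex" where
  "R0_CNAB w w0 = (- (1/2 * w0)) / (1 - 1/2 * w)"

definition C_CNAB :: "complex \<Rightarrow> complex \<Rightarrow> complex ^ 2 ^ 2" where
  "C_CNAB w w0 = vector [vector [R1_CNAB w w0, R0_CNAB w w0],
                         vector [1, 0]]"

text \<open>The operator \<open>^\<close> on vectors and matrices acts entrywise, so powers with respect to
  the matrix product are iterated explicitly.\<close>

definition matpow :: "'a::semiring_1 ^ 'n ^ 'n \<Rightarrow> nat \<Rightarrow> 'a ^ 'n ^ 'n" where
  "matpow A n = (((**) A) ^^ n) (mat 1)"

definition max_norm :: "complex ^ 'n \<Rightarrow> real" where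
  "max_norm x = (MAX i. cmod (x $ i))"

text \<open>The induced norm; as in \<^const>\<open>onorm\<close>, the vector \<open>x = 0\<close> contributes \<open>0 / 0 = 0\<close>
  and does not affect the supremum.\<close>

definition max_matrix_norm :: "complex ^ 'n ^ 'm \<Rightarrow> real" where
  "max_matrix_norm A = (SUP x. max_norm (A *v x) / max_norm x)"

lemma max_norm_ge: "cmod (x $ i) \<le> max_norm x"
  unfolding max_norm_def by (rule Max_ge) auto

lemma max_norm_leI: "(\<And>i. cmod (x $ i) \<le> b) \<Longrightarrow> max_norm x \<le> b"
  unfolding max_norm_def by (subst Max_le_iff) auto

lemma max_norm_nonneg: "0 \<le> max_norm x"
  using max_norm_ge[of x undefined] norm_ge_zero order_trans by blast

lemma max_norm_eq_0_iff: "max_norm x = 0 \<longleftrightarrow> x = 0"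
proof
  assume "max_norm x = 0"
  then have "x $ i = 0" for i
    using max_norm_ge[of x i] by simp
  then show "x = 0" by (simp add: vec_eq_iff)
qed (simp add: max_norm_def)

text \<open>The induced norm is the maximal absolute row sum.\<close>

lemma max_matrix_norm_eq_row_sum:
  "max_matrix_norm (A :: complex ^ 'n ^ 'm) = (MAX i. \<Sum>j\<in>UNIV. cmod (A $ i $ j))"
    (is "_ = ?M")
proof -
  have row: "(\<Sum>j\<in>UNIV. cmod (A $ i $ j)) \<le> ?M" for i
    by (rule Max_ge) auto
  have M0: "0 \<le> ?M"
    by (rule order_trans[OF sum_nonneg row]) simp
  have le: "max_norm (A *v x) \<le> ?M * max_norm x" for x
  proof (rule max_norm_leI)
    fix i
    have "cmod ((A *v x) $ i) \<le> (\<Sum>j\<in>UNIV. cmod (A $ i $ j) * max_norm x)"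
      unfolding matrix_vector_mult_def
      by (auto simp: norm_mult intro!: sum_norm_le mult_left_mono max_norm_ge)
    also have "\<dots> \<le> ?M * max_norm x"
      unfolding sum_distrib_right[symmetric]
      by (rule mult_right_mono[OF row max_norm_nonneg])
    finally show "cmod ((A *v x) $ i) \<le> ?M * max_norm x" .
  qed
  have q: "max_norm (A *v x) / max_norm x \<le> ?M" for x
  proof (cases "max_norm x = 0")
    case False
    then have "max_norm x > 0" using max_norm_nonneg[of x] by linarith
    then show ?thesis using le[of x] by (simp add: pos_divide_le_eq)
  qed (use M0 in simp)
  have bdd: "bdd_above (range (\<lambda>x. max_norm (A *v x) / max_norm x))"
    by (rule bdd_aboveI2[OF q])
  have "?M \<in> range (\<lambda>i. \<Sum>j\<in>UNIV. cmod (A $ i $ j))"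
    by (rule Max_in) auto
  then obtain i where i: "?M = (\<Sum>j\<in>UNIV. cmod (A $ i $ j))" by (elim rangeE)
  define x :: "complex ^ 'n" where "x = (\<chi> j. if A $ i $ j = 0 then 1 else cnj (sgn (A $ i $ j)))"
  have x1: "cmod (x $ j) = 1" for j
    by (simp add: x_def norm_sgn)
  have mx: "max_norm x = 1"
    by (simp add: max_norm_def x1)
  have e: "A $ i $ j * x $ j = of_real (cmod (A $ i $ j))" for j
  proof (cases "A $ i $ j = 0")
    case False
    have "A $ i $ j * cnj (A $ i $ j) = of_real (cmod (A $ i $ j)) * of_real (cmod (A $ i $ j))"
      by (simp add: complex_norm_square[symmetric] power2_eq_square)
    then show ?thesis
      using False by (simp add: x_def sgn_eq)
  qed (simp add: x_def)
  have "(A *v x) $ i = of_real ?M"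
    unfolding i matrix_vector_mult_def by (simp add: e)
  then have "?M \<le> max_norm (A *v x) / max_norm x"
    using max_norm_ge[of "A *v x" i] M0 by (simp add: mx)
  also have "\<dots> \<le> max_matrix_norm A"
    unfolding max_matrix_norm_def by (rule cSUP_upper[OF _ bdd]) simp
  finally have "?M \<le> max_matrix_norm A" .
  moreover have "max_matrix_norm A \<le> ?M"
    unfolding max_matrix_norm_def by (rule cSUP_least) (auto intro: q)
  ultimately show ?thesis by (rule antisym[rotated])
qed

end

theory Submission
  imports Defs
begin

text \<open>
  For \<open>Re w \<le> 0\<close> the denominator \<open>z = 1 - w/2\<close> satisfies \<open>\<bar>z\<bar> \<ge> 1\<close>, and the Crank--Nicolson
  factor \<open>a = (1 + w/2) / z\<close> satisfies \<open>\<bar>a\<bar> \<le> 1\<close>.  Every scheme is a polynomial perturbation of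
  \<open>a\<close> in \<open>w\<^sub>0\<close> and \<open>u = w\<^sub>0 / z\<close>, where \<open>\<bar>u\<bar> \<le> r = \<bar>w\<^sub>0\<bar>\<close>.  The triangle inequality then gives,
  uniformly in \<open>w\<close>,
    \<^item> CNFE: \<open>R = a + u\<close>, hence \<open>\<bar>R\<bar> \<le> 1 + r\<close>;
    \<^item> CNFI: with \<open>q = u/2\<close>, \<open>R = q\<^sup>l + (\<Sum>k<l. q\<^sup>k (a + q))\<close>, and replacing \<open>a\<close> by \<open>1\<close> and \<open>q\<close> by \<open>r/2\<close>
      telescopes to \<open>\<bar>R\<bar> \<le> 1 + r (\<Sum>k<l. (r/2)\<^sup>k) \<le> 1 + c r\<close>, because \<open>r = \<bar>\<lambda>\<^sub>0\<bar> \<Delta>t \<le> \<bar>\<lambda>\<^sub>0\<bar> T\<close>;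
    \<^item> IETR: \<open>R = a + a w\<^sub>0 + w\<^sub>0 u / 2\<close>, hence \<open>\<bar>R\<bar> \<le> 1 + r + r\<^sup>2/2\<close>;
    \<^item> CNAB: the rows of the companion matrix have absolute sums at most \<open>1 + 2 r\<close> and \<open>1\<close>.

  Each right-hand side is at most \<open>exp (C r)\<close> for the constant \<open>C\<close> of the respective claim.  As
  modulus and induced norm are submultiplicative, the \<open>n\<close>-th power is bounded by
  \<open>exp (C r)\<^sup>n = exp (C \<bar>\<lambda>\<^sub>0\<bar> t\<^sub>n)\<close>.
\<close>

section \<open>The Crank--Nicolson factor on the left half-plane\<close>

lemma CN_denominator_ge_1:
  assumes "Re w \<le> 0"
  shows "1 \<le> cmod (1 - 1/2 * w)"
  using complex_Re_le_cmod[of "1 - 1/2 * w"] assms by simp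

lemma cmod_divide_CN_denominator_le:
  assumes "Re w \<le> 0"
  shows "cmod (v / (1 - 1/2 * w)) \<le> cmod v"
  using CN_denominator_ge_1[OF assms] mult_left_mono[of 1 "cmod (1 - 1/2 * w)" "cmod v"]
  by (auto simp: norm_divide divide_le_eq)

text \<open>A-stability of the Crank--Nicolson method: a point \<open>w/2\<close> of the left half-plane is at least
  as close to \<open>-1\<close> as to \<open>1\<close>.\<close>

lemma CN_factor_le_1:
  assumes "Re w \<le> 0"
  shows "cmod ((1 + 1/2 * w) / (1 - 1/2 * w)) \<le> 1"
proof -
  have "(cmod (1 + 1/2 * w))\<^sup>2 \<le> (cmod (1 - 1/2 * w))\<^sup>2"
    using assms unfolding cmod_power2 by (simp add: power2_eq_square algebra_simps)
  then have "cmod (1 + 1/2 * w) \<le> cmod (1 - 1/2 * w)"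
    by (rule power2_le_imp_le) simp
  then show ?thesis
    using CN_denominator_ge_1[OF assms] by (simp add: norm_divide divide_le_eq)
qed

section \<open>One-step bounds\<close>

lemma R_CNFE_le:
  assumes "Re w \<le> 0"
  shows "cmod (R_CNFE w w0) \<le> 1 + cmod w0"
proof -
  have "R_CNFE w w0 = (1 + 1/2 * w) / (1 - 1/2 * w) + w0 / (1 - 1/2 * w)"
    by (simp add: R_CNFE_def add_divide_distrib)
  then show ?thesis
    using norm_triangle_mono[OF CN_factor_le_1[OF assms] cmod_divide_CN_denominator_le[OF assms]]
    by simp
qed

text \<open>When \<open>a\<close> is replaced by \<open>1\<close> and \<open>q\<close> by \<open>s\<close>, the value of the fixed point iteration becomes
  the right-hand side by the geometric identity \<open>s\<^sup>l - 1 = (s - 1) (\<Sum>k<l. s\<^sup>k)\<close>.\<close>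

lemma fixed_point_iteration_le:
  fixes a q :: complex
  assumes "cmod a \<le> 1" and "cmod q \<le> s"
  shows "cmod (q ^ l + (\<Sum>k<l. q ^ k * (a + q))) \<le> 1 + 2 * s * (\<Sum>k<l. s ^ k)"
proof -
  have s0: "0 \<le> s"
    using assms(2) norm_ge_zero order_trans by blast
  have pow: "cmod (q ^ k) \<le> s ^ k" for k
    using assms(2) by (simp add: norm_power power_mono)
  have aq: "cmod (a + q) \<le> 1 + s"
    by (rule norm_triangle_mono[OF assms])
  have "cmod (\<Sum>k<l. q ^ k * (a + q)) \<le> (\<Sum>k<l. s ^ k * (1 + s))"
    unfolding norm_mult using pow aq s0
    by (intro sum_norm_le) (auto simp: norm_mult intro!: mult_mono)
  from norm_triangle_mono[OF pow this]
  have "cmod (q ^ l + (\<Sum>k<l. q ^ k * (a + q))) \<le> s ^ l + (\<Sum>k<l. s ^ k * (1 + s))" .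
  also have "\<dots> = s ^ l + (1 + s) * (\<Sum>k<l. s ^ k)"
    by (simp add: sum_distrib_left mult.commute)
  also have "\<dots> = 1 + 2 * s * (\<Sum>k<l. s ^ k)"
    using power_diff_1_eq[of s l] by (simp add: algebra_simps)
  finally show ?thesis .
qed

lemma R_CNFI_le:
  assumes "Re w \<le> 0"
  shows "cmod (R_CNFI l w w0) \<le> 1 + cmod w0 * (\<Sum>k<l. (1/2 * cmod w0) ^ k)"
proof -
  define a where "a = (1 + 1/2 * w) / (1 - 1/2 * w)"
  define q where "q = 1/2 * w0 / (1 - 1/2 * w)"
  have "cmod a \<le> 1"
    unfolding a_def by (rule CN_factor_le_1[OF assms])
  moreover have "cmod q \<le> 1/2 * cmod w0"
    using cmod_divide_CN_denominator_le[OF assms, of "1/2 * w0"]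
    by (simp add: q_def norm_mult)
  moreover have "R_CNFI l w w0 = q ^ l + (\<Sum>k<l. q ^ k * (a + q))"
    by (simp add: R_CNFI_def a_def q_def add_divide_distrib)
  ultimately show ?thesis
    using fixed_point_iteration_le[of a q "1/2 * cmod w0" l] by simp
qed

text \<open>With \<open>z = 1 - w/2\<close> and \<open>a = (1 + w/2) / z\<close>, bounding the two terms \<open>w\<^sub>0 / z\<close> and
  \<open>w w\<^sub>0 / (2 z)\<close> separately would contribute \<open>2 \<bar>w\<^sub>0\<bar>\<close>, too much for \<open>exp \<bar>w\<^sub>0\<bar>\<close>.  Their sum is
  \<open>a w\<^sub>0\<close>, which contributes only \<open>\<bar>w\<^sub>0\<bar>\<close>.\<close>

lemma R_IETR_le:
  assumes "Re w \<le> 0"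
  shows "cmod (R_IETR w w0) \<le> 1 + cmod w0 + (cmod w0)\<^sup>2 / 2"
proof -
  define a where "a = (1 + 1/2 * w) / (1 - 1/2 * w)"
  have a: "cmod a \<le> 1"
    unfolding a_def by (rule CN_factor_le_1[OF assms])
  have "R_IETR w w0 = (1 + 1/2 * w + (1 + 1/2 * w) * w0 + 1/2 * w0\<^sup>2) / (1 - 1/2 * w)"
    by (simp add: R_IETR_def power2_eq_square algebra_simps)
  then have eq: "R_IETR w w0 = a + a * w0 + (1/2 * w0\<^sup>2) / (1 - 1/2 * w)"
    by (simp only: a_def add_divide_distrib times_divide_eq_left distrib_right)
  have "cmod (a * w0) \<le> cmod w0"
    using a by (simp add: norm_mult mult_left_le_one_le)
  moreover have "cmod ((1/2 * w0\<^sup>2) / (1 - 1/2 * w)) \<le> (cmod w0)\<^sup>2 / 2"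
    using cmod_divide_CN_denominator_le[OF assms, of "1/2 * w0\<^sup>2"]
    by (simp add: norm_mult norm_power)
  ultimately show ?thesis
    unfolding eq using a by (intro norm_triangle_mono)
qed

lemma max_matrix_norm_C_CNAB_le:
  assumes "Re w \<le> 0"
  shows "max_matrix_norm (C_CNAB w w0) \<le> 1 + 2 * cmod w0"
proof -
  have "R1_CNAB w w0 = (1 + 1/2 * w) / (1 - 1/2 * w) + (3/2 * w0) / (1 - 1/2 * w)"
    by (simp add: R1_CNAB_def add_divide_distrib)
  then have R1: "cmod (R1_CNAB w w0) \<le> 1 + 3/2 * cmod w0"
    using norm_triangle_mono[OF CN_factor_le_1[OF assms]
        cmod_divide_CN_denominator_le[OF assms, of "3/2 * w0"]]
    by (simp add: norm_mult)
  have R0: "cmod (R0_CNAB w w0) \<le> 1/2 * cmod w0"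
    using cmod_divide_CN_denominator_le[OF assms, of "- (1/2 * w0)"]
    by (simp add: R0_CNAB_def norm_mult)
  show ?thesis
    unfolding max_matrix_norm_eq_row_sum
    using R1 R0 by (subst Max_le_iff) (auto simp: sum_2 forall_2 C_CNAB_def)
qed

section \<open>Powers\<close>

lemma max_norm_matrix_vector_le:
  "max_norm (A *v x) \<le> max_matrix_norm A * max_norm x"
proof (rule max_norm_leI)
  fix i
  have "cmod ((A *v x) $ i) \<le> (\<Sum>j\<in>UNIV. cmod (A $ i $ j) * max_norm x)"
    unfolding matrix_vector_mult_def
    by (auto simp: norm_mult intro!: sum_norm_le mult_left_mono max_norm_ge)
  also have "\<dots> \<le> max_matrix_norm A * max_norm x"
    unfolding max_matrix_norm_eq_row_sum sum_distrib_right[symmetric]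
    by (intro mult_right_mono max_norm_nonneg Max_ge) auto
  finally show "cmod ((A *v x) $ i) \<le> max_matrix_norm A * max_norm x" .
qed

lemma max_matrix_norm_leI:
  assumes "0 \<le> b" and "\<And>x. max_norm (A *v x) \<le> b * max_norm x"
  shows "max_matrix_norm A \<le> b"
  unfolding max_matrix_norm_def
proof (rule cSUP_least)
  fix x
  show "max_norm (A *v x) / max_norm x \<le> b"
    using assms max_norm_nonneg[of x] by (cases "max_norm x = 0") (auto simp: divide_le_eq)
qed simp

lemma max_norm_matpow_vector_le:
  assumes "max_matrix_norm A \<le> b" and "0 \<le> b"
  shows "max_norm (matpow A n *v x) \<le> b ^ n * max_norm x"
proof (induction n)
  case 0
  show ?case by (simp add: matpow_def)
next
  case (Suc n)
  have "max_norm (matpow A (Suc n) *v x) = max_norm (A *v (matpow A n *v x))"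
    by (simp add: matpow_def matrix_vector_mul_assoc)
  also have "\<dots> \<le> max_matrix_norm A * max_norm (matpow A n *v x)"
    by (rule max_norm_matrix_vector_le)
  also have "\<dots> \<le> b * (b ^ n * max_norm x)"
    using Suc assms max_norm_nonneg by (intro mult_mono) auto
  finally show ?case by (simp add: mult.assoc)
qed

lemma max_matrix_norm_matpow_le:
  assumes "max_matrix_norm A \<le> b" and "0 \<le> b"
  shows "max_matrix_norm (matpow A n) \<le> b ^ n"
  using assms by (intro max_matrix_norm_leI[OF _ max_norm_matpow_vector_le]) auto

lemma power_exp_le:
  fixes x y :: real
  assumes "0 \<le> x" and "x \<le> exp y"
  shows "x ^ n \<le> exp (y * real n)"
  using power_mono[OF assms(2,1), of n] by (simp add: exp_of_nat2_mult)

section \<open>Stability of the four schemes\<close>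

theorem theorem1:
  fixes T dt c :: real and N l n :: nat and t :: "nat \<Rightarrow> real" and lam0 w0 w :: complex
  assumes "T > 0" and "N \<ge> 1"
    and "dt = T / real N"
    and "\<And>k. k \<le> N \<Longrightarrow> t k = real k * dt"
    and "w0 = lam0 * complex_of_real dt"
    and "l \<ge> 1"
    and "c = (\<Sum>k<l. (1/2 * cmod lam0 * T) ^ k)"
    and "Re w \<le> 0" and "n \<le> N"
  shows "cmod (R_CNFE w w0 ^ n) \<le> exp (cmod lam0 * t n) \<and>
         cmod (R_CNFI l w w0 ^ n) \<le> exp (c * cmod lam0 * t n) \<and>
         cmod (R_IETR w w0 ^ n) \<le> exp (cmod lam0 * t n) \<and>
         max_matrix_norm (matpow (C_CNAB w w0) n) \<le> exp (2 * cmod lam0 * t n)"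
proof -
  define r where "r = cmod w0"
  have dt: "0 \<le> dt" "dt \<le> T"
    using assms(1-3) by (auto simp: divide_le_eq)
  have r: "r = cmod lam0 * dt"
    using dt by (simp add: r_def assms(5) norm_mult)
  have r0: "0 \<le> r"
    by (simp add: r_def)
  have tn: "cmod lam0 * t n = r * real n"
    using assms(4)[OF assms(9)] by (simp add: r)
  have "1/2 * r \<le> 1/2 * cmod lam0 * T"
    using dt by (simp add: r mult_left_mono)
  then have c: "(\<Sum>k<l. (1/2 * r) ^ k) \<le> c"
    unfolding assms(7) using r0 by (intro sum_mono power_mono) auto

  have "cmod (R_CNFE w w0) \<le> exp r"
    using R_CNFE_le[OF assms(8), of w0] exp_ge_add_one_self[of r] unfolding r_def by linarith
  then have "cmod (R_CNFE w w0 ^ n) \<le> exp (cmod lam0 * t n)"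
    unfolding tn norm_power by (intro power_exp_le) auto
  moreover
  have "cmod (R_CNFI l w w0) \<le> 1 + c * r"
    using R_CNFI_le[OF assms(8), of l w0] mult_left_mono[OF c r0]
    by (simp add: r_def mult.commute)
  then have "cmod (R_CNFI l w w0) \<le> exp (c * r)"
    using exp_ge_add_one_self[of "c * r"] by linarith
  then have "cmod (R_CNFI l w w0 ^ n) \<le> exp (c * cmod lam0 * t n)"
    using power_exp_le[of "cmod (R_CNFI l w w0)" "c * r" n]
    by (simp add: norm_power tn mult.assoc)
  moreover
  have "cmod (R_IETR w w0) \<le> exp r"
    using R_IETR_le[OF assms(8), of w0] exp_lower_Taylor_quadratic[OF r0] unfolding r_def by linarith
  then have "cmod (R_IETR w w0 ^ n) \<le> exp (cmod lam0 * t n)"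
    unfolding tn norm_power by (intro power_exp_le) auto
  moreover
  have "max_matrix_norm (matpow (C_CNAB w w0) n) \<le> (1 + 2 * r) ^ n"
    using max_matrix_norm_C_CNAB_le[OF assms(8), of w0] r0
    by (intro max_matrix_norm_matpow_le) (auto simp: r_def)
  then have "max_matrix_norm (matpow (C_CNAB w w0) n) \<le> exp (2 * cmod lam0 * t n)"
    using power_exp_le[of "1 + 2 * r" "2 * r" n] exp_ge_add_one_self[of "2 * r"] r0 tn
    by (simp add: mult.assoc)
  ultimately show ?thesis
    by blast
qed

end
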